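(* Let $A,B>0$, consider the reflectionless case $b(k)=0$ with $$a_1(k)=\frac{(k-z_1)(k-z_2)}{k^2-B^2},\qquad a_2(k)=\frac{k^2-B^2}{(k-z_1)(k-z_2)},$$ where $(z_1,z_2)=(\mathrm{i}k_1,\mathrm{i}k_2)$ in Case $\widetilde{\mathrm I}$ ($0<B<\frac A4$), $(z_1,z_2)=(p_1,-\bar p_1)$ in Case $\widetilde{\mathrm{II}}$ ($B>\frac A4$), $z_1=z_2=\mathrm{i}\ell_1$ in Case $\widetilde{\mathrm{III}}$ ($B=\frac A4$), with $k_j=\frac14(A+(-1)^j\sqrt{A^2-16B^2})$, $j=1,2$, $p_1=\frac14(-\sqrt{16B^2-A^2}+\mathrm{i}A)$, $\ell_1=\frac A4$. Let $\phi=\phi(x,t)=2Bx+8B^3t$, $s_1=\sqrt{A^2-16B^2}$ for $0<B<\frac A4$, and $s_2=\sqrt{16B^2-A^2}$ for $B>\frac A4$. Then the nonlocal mKdV equation $$u_t(x,t)+6u(x,t)u(-x,-t)u_x(x,t)+u_{xxx}(x,t)=0$$ admits the following (kink-type two-soliton) solutions corresponding to these cases, where only those $(x,t)\in\mathbb{R}^2$ are considered for which the denominator is nonzero: Case $\widetilde{\mathrm I}$ ($0<B<\frac A4$): with $\phi_j(x,t)=-2k_jx+8k_j^3t$, $j=1,2$, and any $\gamma_1,\gamma_2\in\{1,-1\}$, $$u(x,t)=\frac{A\left(s_1\cos\phi-\frac12\left(A(\gamma_1e^{\phi_1}-\gamma_2e^{\phi_2})+s_1(\gamma_1e^{\phi_1}+\gamma_2e^{\phi_2})\right)\right)}{s_1-s_1(\gamma_1e^{\phi_1}+\gamma_2e^{\phi_2})\cos\phi-4B(\gamma_1e^{\phi_1}-\gamma_2e^{\phi_2})\sin\phi+\gamma_1\gamma_2s_1e^{\phi_1+\phi_2}};$$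 Case $\widetilde{\mathrm{II}}$ ($B>\frac A4$): with $\phi_3(x,t)=-\frac A2\left(x+t(12B^2-A^2)\right)$, $\phi_4(x,t)=-\frac{s_2}2\left(x+t(4B^2-A^2)\right)$, and any $\eta_1\in\{1,-1\}$, $$u(x,t)=\frac{A\left(s_2\cos\phi+\eta_1e^{\phi_3}(A\sin\phi_4-s_2\cos\phi_4)\right)}{s_2\left(e^{2\phi_3}+1\right)+2\eta_1e^{\phi_3}\left(4B\sin\phi_4\sin\phi-s_2\cos\phi_4\cos\phi\right)};$$ Case $\widetilde{\mathrm{III}}$ ($B=\frac A4$): with $\phi_5(x,t)=-2\ell_1x+8\ell_1^3t$ and any $\nu_1\in\{1,-1\}$, $$u(x,t)=\frac{A\left(\cos\phi-\nu_1e^{\phi_5}-\frac{\nu_1}2e^{\phi_5}\left(Ax-\frac34A^3t\right)\right)}{e^{2\phi_5}-\nu_1e^{\phi_5}\left(2\cos\phi+\left(Ax-\frac34A^3t\right)\sin\phi\right)+1}.$$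
   Context: Here $a_1,a_2,b$ are the spectral functions of the Riemann-Hilbert approach to the nonlocal mKdV equation with boundary conditions $u(x,t)\to0$ as $x\to-\infty$, $u(x,t)=A\cos(2Bx+8B^3t)+o(1)$ as $x\to\infty$; they only serve to label the families, and the constants $\gamma_j,\eta_1,\nu_1$ are the norming constants at the zeros $z_1,z_2$ of $a_1$. The solution formulas themselves are fully explicit, and the assertion is that each function satisfies the displayed equation. *)

theory Defs
  imports "HOL-Analysis.Analysis"
begin

(* Classical solutions of u_t(x,t) + 6 u(x,t) u(-x,-t) u_x(x,t) + u_xxx(x,t) = 0 on a set W of
   pairs (x,t).  W has to be open, so that the functions ux, uxx, uxxx, which are only constrained
   on W, are the iterated partial derivatives of u there, and invariant under (x,t) -> (-x,-t), so
   that the nonlocal term only uses values of u on W. *)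
definition nonlocal_mKdV_solution_on ::
  "(real \<times> real) set \<Rightarrow> (real \<Rightarrow> real \<Rightarrow> real) \<Rightarrow> bool" where
  "nonlocal_mKdV_solution_on W u \<longleftrightarrow>
     open W \<and> (\<forall>(x, t) \<in> W. (-x, -t) \<in> W) \<and>
     (\<exists>ut ux uxx uxxx. \<forall>(x, t) \<in> W.
        ((\<lambda>\<tau>. u x \<tau>) has_real_derivative ut x t) (at t) \<and>
        ((\<lambda>\<xi>. u \<xi> t) has_real_derivative ux x t) (at x) \<and>
        ((\<lambda>\<xi>. ux \<xi> t) has_real_derivative uxx x t) (at x) \<and>
        ((\<lambda>\<xi>. uxx \<xi> t) has_real_derivative uxxx x t) (at x) \<and>
        ut x t + 6 * u x t * u (-x) (-t) * ux x t + uxxx x t = 0)"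

(* The suffixes I, II, III refer to the regimes 0 < B < A/4, B > A/4 and B = A/4; outside its regime
   the corresponding formula has no meaning (s1 and s2 become roots of nonpositive numbers).  The
   quotients u_I, u_II, u_III are 0 where their denominator vanishes, so they are to be used only
   off the zero set of den_I, den_II, den_III. *)
definition phi :: "real \<Rightarrow> real \<Rightarrow> real \<Rightarrow> real" where
  "phi B x t = 2 * B * x + 8 * B ^ 3 * t"

definition s1 :: "real \<Rightarrow> real \<Rightarrow> real" where
  "s1 A B = sqrt (A ^ 2 - 16 * B ^ 2)"

definition kk :: "real \<Rightarrow> real \<Rightarrow> nat \<Rightarrow> real" where
  "kk A B j = (A + (-1) ^ j * sqrt (A ^ 2 - 16 * B ^ 2)) / 4"

definition phi_I :: "real \<Rightarrow> real \<Rightarrow> nat \<Rightarrow> real \<Rightarrow> real \<Rightarrow> real" where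
  "phi_I A B j x t = - 2 * kk A B j * x + 8 * kk A B j ^ 3 * t"

definition num_I :: "real \<Rightarrow> real \<Rightarrow> real \<Rightarrow> real \<Rightarrow> real \<Rightarrow> real \<Rightarrow> real" where
  "num_I A B \<gamma>1 \<gamma>2 x t =
     A * (s1 A B * cos (phi B x t)
        - 1/2 * (A * (\<gamma>1 * exp (phi_I A B 1 x t) - \<gamma>2 * exp (phi_I A B 2 x t))
               + s1 A B * (\<gamma>1 * exp (phi_I A B 1 x t) + \<gamma>2 * exp (phi_I A B 2 x t))))"

definition den_I :: "real \<Rightarrow> real \<Rightarrow> real \<Rightarrow> real \<Rightarrow> real \<Rightarrow> real \<Rightarrow> real" where
  "den_I A B \<gamma>1 \<gamma>2 x t =
     s1 A B
     - s1 A B * (\<gamma>1 * exp (phi_I A B 1 x t) + \<gamma>2 * exp (phi_I A B 2 x t)) * cos (phi B x t)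
     - 4 * B * (\<gamma>1 * exp (phi_I A B 1 x t) - \<gamma>2 * exp (phi_I A B 2 x t)) * sin (phi B x t)
     + \<gamma>1 * \<gamma>2 * s1 A B * exp (phi_I A B 1 x t + phi_I A B 2 x t)"

definition u_I :: "real \<Rightarrow> real \<Rightarrow> real \<Rightarrow> real \<Rightarrow> real \<Rightarrow> real \<Rightarrow> real" where
  "u_I A B \<gamma>1 \<gamma>2 x t = num_I A B \<gamma>1 \<gamma>2 x t / den_I A B \<gamma>1 \<gamma>2 x t"

definition s2 :: "real \<Rightarrow> real \<Rightarrow> real" where
  "s2 A B = sqrt (16 * B ^ 2 - A ^ 2)"

definition phi3 :: "real \<Rightarrow> real \<Rightarrow> real \<Rightarrow> real \<Rightarrow> real" where
  "phi3 A B x t = - (A / 2) * (x + t * (12 * B ^ 2 - A ^ 2))"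

definition phi4 :: "real \<Rightarrow> real \<Rightarrow> real \<Rightarrow> real \<Rightarrow> real" where
  "phi4 A B x t = - (s2 A B / 2) * (x + t * (4 * B ^ 2 - A ^ 2))"

definition num_II :: "real \<Rightarrow> real \<Rightarrow> real \<Rightarrow> real \<Rightarrow> real \<Rightarrow> real" where
  "num_II A B \<eta>1 x t =
     A * (s2 A B * cos (phi B x t)
        + \<eta>1 * exp (phi3 A B x t) * (A * sin (phi4 A B x t) - s2 A B * cos (phi4 A B x t)))"

definition den_II :: "real \<Rightarrow> real \<Rightarrow> real \<Rightarrow> real \<Rightarrow> real \<Rightarrow> real" where
  "den_II A B \<eta>1 x t =
     s2 A B * (exp (2 * phi3 A B x t) + 1)
     + 2 * \<eta>1 * exp (phi3 A B x t)
         * (4 * B * sin (phi4 A B x t) * sin (phi B x t)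
            - s2 A B * cos (phi4 A B x t) * cos (phi B x t))"

definition u_II :: "real \<Rightarrow> real \<Rightarrow> real \<Rightarrow> real \<Rightarrow> real \<Rightarrow> real" where
  "u_II A B \<eta>1 x t = num_II A B \<eta>1 x t / den_II A B \<eta>1 x t"

definition l1 :: "real \<Rightarrow> real" where
  "l1 A = A / 4"

definition phi5 :: "real \<Rightarrow> real \<Rightarrow> real \<Rightarrow> real" where
  "phi5 A x t = - 2 * l1 A * x + 8 * l1 A ^ 3 * t"

definition num_III :: "real \<Rightarrow> real \<Rightarrow> real \<Rightarrow> real \<Rightarrow> real \<Rightarrow> real" where
  "num_III A B \<nu>1 x t =
     A * (cos (phi B x t) - \<nu>1 * exp (phi5 A x t)
        - \<nu>1 / 2 * exp (phi5 A x t) * (A * x - 3/4 * A ^ 3 * t))"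

definition den_III :: "real \<Rightarrow> real \<Rightarrow> real \<Rightarrow> real \<Rightarrow> real \<Rightarrow> real" where
  "den_III A B \<nu>1 x t =
     exp (2 * phi5 A x t)
     - \<nu>1 * exp (phi5 A x t)
         * (2 * cos (phi B x t) + (A * x - 3/4 * A ^ 3 * t) * sin (phi B x t))
     + 1"

definition u_III :: "real \<Rightarrow> real \<Rightarrow> real \<Rightarrow> real \<Rightarrow> real \<Rightarrow> real" where
  "u_III A B \<nu>1 x t = num_III A B \<nu>1 x t / den_III A B \<nu>1 x t"

end

(*
  Write u = g/f and u(-x,-t) = h/f.  The equation follows from the Hirota bilinear equations
  D_x^2 f.f = 2 g h and (D_t + D_x^3) g.f = 0.  With s^2 = A^2 - 16 B^2, all three families have,
  up to a common factor,
    f = 1 - P cos phi - 4 B Q sin phi + (P^2 - s^2 Q^2)/4  and  g = A (cos phi - (A Q + P)/2),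
  where P = E1 + E2 and Q = (E1 - E2)/s for exponentials E1, E2 with spatial rates -(A -+ s)/2.
  In the second case s is imaginary, in the third Q is the limit s -> 0; in all cases (P, Q) solves
  the same linear system, whose coefficients contain only A and s^2, so the bilinear equations
  need to be checked only once.
*)

theory Submission
  imports Defs
begin

section \<open>From Hirota's bilinear equations to classical solutions\<close>

text \<open>For u = g/f one has u_t + u_xxx = (D_t + D_x^3) g.f / f^2 - 3 u_x (D_x^2 f.f) / f^2. By
  \<open>bil3\<close> the first term vanishes, and by \<open>bil2\<close> the second is -6 u (h/f)
  u_x. The multiplier \<open>m\<close> allows reflection to reproduce \<open>f\<close> only up to a
  nonvanishing factor: it cancels in the quotient and keeps the zero set of \<open>f\<close>
  symmetric.\<close>

lemma nonlocal_mKdV_Hirota: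
  fixes f f1 f2 f3 ft g g1 g2 g3 gt h m :: "real \<Rightarrow> real \<Rightarrow> real"
  assumes cont: "continuous_on UNIV (\<lambda>(x, t). f x t)"
    and f: "\<And>x t. ((\<lambda>\<xi>. f \<xi> t) has_real_derivative f1 x t) (at x)"
      "\<And>x t. ((\<lambda>\<xi>. f1 \<xi> t) has_real_derivative f2 x t) (at x)"
      "\<And>x t. ((\<lambda>\<xi>. f2 \<xi> t) has_real_derivative f3 x t) (at x)"
      "\<And>x t. ((\<lambda>\<tau>. f x \<tau>) has_real_derivative ft x t) (at t)"
    and g: "\<And>x t. ((\<lambda>\<xi>. g \<xi> t) has_real_derivative g1 x t) (at x)"
      "\<And>x t. ((\<lambda>\<xi>. g1 \<xi> t) has_real_derivative g2 x t) (at x)"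
      "\<And>x t. ((\<lambda>\<xi>. g2 \<xi> t) has_real_derivative g3 x t) (at x)"
      "\<And>x t. ((\<lambda>\<tau>. g x \<tau>) has_real_derivative gt x t) (at t)"
    and m: "\<And>x t. m x t \<noteq> 0"
    and reflect: "\<And>x t. f (-x) (-t) = m x t * f x t"
      "\<And>x t. g (-x) (-t) = m x t * h x t"
    and bil2: "\<And>x t. f x t * f2 x t - (f1 x t)\<^sup>2 = g x t * h x t"
    and bil3: "\<And>x t. gt x t * f x t - g x t * ft x t + g3 x t * f x t
        - 3 * g2 x t * f1 x t + 3 * g1 x t * f2 x t - g x t * f3 x t = 0"
  shows "nonlocal_mKdV_solution_on {(x, t). f x t \<noteq> 0} (\<lambda>x t. g x t / f x t)"
proof -
  let ?W = "{(x, t). f x t \<noteq> 0}"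
  \<comment> \<open>With N = g1 f - g f1 one has N_x = g2 f - g f2. From \<open>ux\<close> = N / f^2
    on, each derivative of a quotient n / f^k is written as (n_x f - k f1 n) / f^(k+1), so no larger
    powers of \<open>f\<close> appear.\<close>
  define ut where "ut x t = (gt x t * f x t - g x t * ft x t) / (f x t)\<^sup>2" for x t
  define ux where "ux x t = (g1 x t * f x t - g x t * f1 x t) / (f x t)\<^sup>2" for x t
  define uxx where "uxx x t = ((g2 x t * f x t - g x t * f2 x t) * f x t
      - 2 * f1 x t * (g1 x t * f x t - g x t * f1 x t)) / f x t ^ 3" for x t
  define uxxx where "uxxx x t =
      (((g3 x t * f x t + g2 x t * f1 x t - g1 x t * f2 x t - g x t * f3 x t) * f x t
        + (g2 x t * f x t - g x t * f2 x t) * f1 x t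
        - 2 * f2 x t * (g1 x t * f x t - g x t * f1 x t)
        - 2 * f1 x t * (g2 x t * f x t - g x t * f2 x t)) * f x t
       - 3 * f1 x t * ((g2 x t * f x t - g x t * f2 x t) * f x t
      - 2 * f1 x t * (g1 x t * f x t - g x t * f1 x t))) / f x t ^ 4" for x t
  \<comment> \<open>Joint continuity of \<open>f\<close> enters here; the partial derivatives alone
    would not give openness.\<close>
  have "open (- {p \<in> UNIV. (\<lambda>(x, t). f x t) p = 0})"
    using continuous_closed_preimage_constant[OF cont, of 0] by (simp add: open_Compl)
  moreover have "- {p \<in> UNIV. (\<lambda>(x, t). f x t) p = 0} = ?W" by auto
  ultimately have opn: "open ?W" by simp
  have "((\<lambda>\<tau>. g x \<tau> / f x \<tau>) has_real_derivative ut x t) (at t)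
      \<and> ((\<lambda>\<xi>. g \<xi> t / f \<xi> t) has_real_derivative ux x t) (at x)
      \<and> ((\<lambda>\<xi>. ux \<xi> t) has_real_derivative uxx x t) (at x)
      \<and> ((\<lambda>\<xi>. uxx \<xi> t) has_real_derivative uxxx x t) (at x)
      \<and> ut x t + 6 * (g x t / f x t) * (g (-x) (-t) / f (-x) (-t)) * ux x t + uxxx x t = 0"
    if nz: "f x t \<noteq> 0" for x t
  proof (intro conjI)
    show "((\<lambda>\<tau>. g x \<tau> / f x \<tau>) has_real_derivative ut x t) (at t)"
      unfolding ut_def using nz
      by (auto intro!: derivative_eq_intros f g simp: power2_eq_square)
    show "((\<lambda>\<xi>. g \<xi> t / f \<xi> t) has_real_derivative ux x t) (at x)"
      unfolding ux_def using nz
      by (auto intro!: derivative_eq_intros f g simp: power2_eq_square)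
    show "((\<lambda>\<xi>. ux \<xi> t) has_real_derivative uxx x t) (at x)"
      unfolding ux_def uxx_def using nz
      by (auto intro!: derivative_eq_intros f g simp: field_simps power_numeral_reduce)
    show "((\<lambda>\<xi>. uxx \<xi> t) has_real_derivative uxxx x t) (at x)"
      unfolding uxx_def uxxx_def using nz
      by (auto intro!: derivative_eq_intros f g simp: field_simps power_numeral_reduce)
    \<comment> \<open>The factor \<open>m\<close> cancels, so the reflected solution is h/f; by
      \<open>bil2\<close> the product u(x,t) u(-x,-t) equals (log f)_xx, which no longer contains
      \<open>h\<close>.\<close>
    have "g (-x) (-t) / f (-x) (-t) = h x t / f x t"
      using m[of x t] by (simp add: reflect)
    moreover have "g x t * h x t / (f x t)\<^sup>2 = (f x t * f2 x t - (f1 x t)\<^sup>2) / (f x t)\<^sup>2"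
      by (simp add: bil2)
    ultimately have v: "(g x t / f x t) * (g (-x) (-t) / f (-x) (-t))
        = (f x t * f2 x t - (f1 x t)\<^sup>2) / (f x t)\<^sup>2"
      by (simp add: power2_eq_square)
    \<comment> \<open>With (log f)_xx in place of the nonlocal product, all terms with denominators
      \<open>f ^ 3\<close> and \<open>f ^ 4\<close> cancel and the bilinear expression over f^2
      remains.\<close>
    have "ut x t + 6 * ((f x t * f2 x t - (f1 x t)\<^sup>2) / (f x t)\<^sup>2) * ux x t + uxxx x t =
      (gt x t * f x t - g x t * ft x t + g3 x t * f x t
        - 3 * g2 x t * f1 x t + 3 * g1 x t * f2 x t - g x t * f3 x t) / (f x t)\<^sup>2"
      unfolding ut_def ux_def uxxx_def using nz
      by (simp add: field_simps power_numeral_reduce)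
    also have "\<dots> = 0" by (simp add: bil3)
    finally show "ut x t + 6 * (g x t / f x t) * (g (-x) (-t) / f (-x) (-t)) * ux x t + uxxx x t = 0"
      by (simp only: v mult.assoc[of 6])
  qed
  then have "\<forall>(x, t) \<in> ?W. ((\<lambda>\<tau>. g x \<tau> / f x \<tau>) has_real_derivative ut x t) (at t)
      \<and> ((\<lambda>\<xi>. g \<xi> t / f \<xi> t) has_real_derivative ux x t) (at x)
      \<and> ((\<lambda>\<xi>. ux \<xi> t) has_real_derivative uxx x t) (at x)
      \<and> ((\<lambda>\<xi>. uxx \<xi> t) has_real_derivative uxxx x t) (at x)
      \<and> ut x t + 6 * (g x t / f x t) * (g (-x) (-t) / f (-x) (-t)) * ux x t + uxxx x t = 0"
    by auto
  moreover have "\<forall>(x, t) \<in> ?W. (-x, -t) \<in> ?W"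
    using m by (auto simp: reflect)
  ultimately show ?thesis
    unfolding nonlocal_mKdV_solution_on_def using opn by blast
qed

section \<open>The bilinear equations as polynomial identities\<close>

text \<open>Real numbers stand for values at one point: the suffixes \<open>1\<close>, \<open>2\<close>, \<open>3\<close> mark iterated
  \<open>x\<close>-derivatives, the suffix \<open>t\<close> the \<open>t\<close>-derivative, and \<open>c\<close>, \<open>s\<close> are
  \<open>cos \<phi>\<close>, \<open>sin \<phi>\<close>.\<close>

lemma kink_bilinear_identities:
  fixes A B D P P1 P2 P3 Q Q1 Q2 Q3 R c s f f1 f2 f3 ft g g1 g2 g3 gt h :: real
  assumes cs: "c\<^sup>2 + s\<^sup>2 = 1" and D: "D = A\<^sup>2 - 16 * B\<^sup>2"
    and P: "P1 = (D * Q - A * P) / 2" "P2 = (D * Q1 - A * P1) / 2" "P3 = (D * Q2 - A * P2) / 2"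
    and Q: "Q1 = (P - A * Q) / 2" "Q2 = (P1 - A * Q1) / 2" "Q3 = (P2 - A * Q2) / 2"
    and R: "R = (P\<^sup>2 - D * Q\<^sup>2) / 4"
    and f: "f = 1 - P * c - 4 * B * Q * s + R"
      "f1 = - (P1 * c - 2 * B * P * s) - 4 * B * (Q1 * s + 2 * B * Q * c) - A * R"
      "f2 = - (P2 * c - 4 * B * P1 * s - 4 * B\<^sup>2 * P * c)
            - 4 * B * (Q2 * s + 4 * B * Q1 * c - 4 * B\<^sup>2 * Q * s) + A\<^sup>2 * R"
      "f3 = - (P3 * c - 6 * B * P2 * s - 12 * B\<^sup>2 * P1 * c + 8 * B ^ 3 * P * s)
            - 4 * B * (Q3 * s + 6 * B * Q2 * c - 12 * B\<^sup>2 * Q1 * s - 8 * B ^ 3 * Q * c) - A ^ 3 * R"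
      "ft = (P3 * c + 8 * B ^ 3 * P * s) + 4 * B * (Q3 * s - 8 * B ^ 3 * Q * c)
            - (P * P3 - D * Q * Q3) / 2"
    and g: "g = A * (c - (A * Q + P) / 2)"
      "g1 = A * (- 2 * B * s - (A * Q1 + P1) / 2)"
      "g2 = A * (- 4 * B\<^sup>2 * c - (A * Q2 + P2) / 2)"
      "g3 = A * (8 * B ^ 3 * s - (A * Q3 + P3) / 2)"
      "gt = A * (- 8 * B ^ 3 * s + (A * Q3 + P3) / 2)"
    and h: "h = A * (R * c + (A * Q - P) / 2)"
  shows "f * f2 - f1\<^sup>2 = g * h"
    and "gt * f - g * ft + g3 * f - 3 * g2 * f1 + 3 * g1 * f2 - g * f3 = 0"
proof -
  \<comment> \<open>The Pythagorean relation is oriented as a rewrite rule that eliminates squares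
    of \<open>c\<close>; \<open>c3\<close> catches such a square inside a right-nested product.
    Everything else is reduced to polynomials in \<open>A\<close>, \<open>B\<close>,
    \<open>P\<close>, \<open>Q\<close>, \<open>c\<close>, \<open>s\<close>.\<close>
  have c2: "c * c = 1 - s * s" using cs by (simp add: power2_eq_square)
  have c3: "c * (c * x) = x - s * (s * x)" for x
    using arg_cong[OF c2, of "\<lambda>z. z * x"] by (simp add: algebra_simps)
  show "f * f2 - f1\<^sup>2 = g * h"
    unfolding f g h R P Q D
    by (simp add: field_simps power_numeral_reduce c2 c3)
  show "gt * f - g * ft + g3 * f - 3 * g2 * f1 + 3 * g1 * f2 - g * f3 = 0"
    unfolding f g h R P Q D
    by (simp add: field_simps power_numeral_reduce)
qed

section \<open>Kink solutions from the linear system for P and Q\<close>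

text \<open>The hypotheses on the derivatives of \<open>P\<close> and \<open>Q\<close> in \<open>t\<close> say that
  \<open>P\<^sub>t = - P\<^sub>x\<^sub>x\<^sub>x\<close> and \<open>Q\<^sub>t = - Q\<^sub>x\<^sub>x\<^sub>x\<close>, with the third derivatives computed from
  the linear system in \<open>x\<close>.\<close>

lemma kink_solution:
  fixes A B D r :: real and P Q num den :: "real \<Rightarrow> real \<Rightarrow> real"
  assumes D: "D = A\<^sup>2 - 16 * B\<^sup>2"
    and cont: "continuous_on UNIV (\<lambda>p. P (fst p) (snd p))"
      "continuous_on UNIV (\<lambda>p. Q (fst p) (snd p))"
    and Px: "\<And>x t. ((\<lambda>\<xi>. P \<xi> t) has_real_derivative (D * Q x t - A * P x t) / 2) (at x)"
    and Qx: "\<And>x t. ((\<lambda>\<xi>. Q \<xi> t) has_real_derivative (P x t - A * Q x t) / 2) (at x)"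
    and Pt: "\<And>x t. ((\<lambda>\<tau>. P x \<tau>) has_real_derivative
      ((A ^ 3 + 3 * A * D) * P x t - (3 * A\<^sup>2 * D + D\<^sup>2) * Q x t) / 8) (at t)"
    and Qt: "\<And>x t. ((\<lambda>\<tau>. Q x \<tau>) has_real_derivative
      ((A ^ 3 + 3 * A * D) * Q x t - (3 * A\<^sup>2 + D) * P x t) / 8) (at t)"
    and nz: "\<And>x t. (P x t)\<^sup>2 - D * (Q x t)\<^sup>2 \<noteq> 0"
    and reflect: "\<And>x t. P (-x) (-t) = 4 * P x t / ((P x t)\<^sup>2 - D * (Q x t)\<^sup>2)"
      "\<And>x t. Q (-x) (-t) = - 4 * Q x t / ((P x t)\<^sup>2 - D * (Q x t)\<^sup>2)"
    and "r \<noteq> 0"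
    and num: "\<And>x t. num x t = r * (A * (cos (phi B x t) - (A * Q x t + P x t) / 2))"
    and den: "\<And>x t. den x t = r * (1 - P x t * cos (phi B x t)
      - 4 * B * Q x t * sin (phi B x t) + ((P x t)\<^sup>2 - D * (Q x t)\<^sup>2) / 4)"
  shows "nonlocal_mKdV_solution_on {(x, t). den x t \<noteq> 0} (\<lambda>x t. num x t / den x t)"
proof -
  define c where "c x t = cos (phi B x t)" for x t
  define s where "s x t = sin (phi B x t)" for x t
  define R where "R x t = ((P x t)\<^sup>2 - D * (Q x t)\<^sup>2) / 4" for x t
  define P1 where "P1 x t = (D * Q x t - A * P x t) / 2" for x t
  define Q1 where "Q1 x t = (P x t - A * Q x t) / 2" for x t
  define P2 where "P2 x t = (D * Q1 x t - A * P1 x t) / 2" for x t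
  define Q2 where "Q2 x t = (P1 x t - A * Q1 x t) / 2" for x t
  define P3 where "P3 x t = (D * Q2 x t - A * P2 x t) / 2" for x t
  define Q3 where "Q3 x t = (P2 x t - A * Q2 x t) / 2" for x t
  have cx: "((\<lambda>\<xi>. c \<xi> t) has_real_derivative - 2 * B * s x t) (at x)"
    and sx: "((\<lambda>\<xi>. s \<xi> t) has_real_derivative 2 * B * c x t) (at x)"
    and ct: "((\<lambda>\<tau>. c x \<tau>) has_real_derivative - 8 * B ^ 3 * s x t) (at t)"
    and st: "((\<lambda>\<tau>. s x \<tau>) has_real_derivative 8 * B ^ 3 * c x t) (at t)" for x t
    unfolding c_def s_def phi_def by (auto intro!: derivative_eq_intros)
  have P0: "((\<lambda>\<xi>. P \<xi> t) has_real_derivative P1 x t) (at x)"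
    and Q0: "((\<lambda>\<xi>. Q \<xi> t) has_real_derivative Q1 x t) (at x)" for x t
    unfolding P1_def Q1_def by (rule Px Qx)+
  have P1: "((\<lambda>\<xi>. P1 \<xi> t) has_real_derivative P2 x t) (at x)"
    and Q1: "((\<lambda>\<xi>. Q1 \<xi> t) has_real_derivative Q2 x t) (at x)" for x t
    unfolding P1_def[abs_def] Q1_def[abs_def] P2_def Q2_def
    by (auto intro!: derivative_eq_intros P0 Q0 simp: P1_def Q1_def)
  have P2: "((\<lambda>\<xi>. P2 \<xi> t) has_real_derivative P3 x t) (at x)"
    and Q2: "((\<lambda>\<xi>. Q2 \<xi> t) has_real_derivative Q3 x t) (at x)" for x t
    unfolding P2_def[abs_def] Q2_def[abs_def] P3_def Q3_def
    by (auto intro!: derivative_eq_intros P1 Q1 simp: P2_def Q2_def)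
  \<comment> \<open>If M is the matrix of the x-system, then M = -A/2 + N with N^2 = D/4, and
    expanding -M^3 yields the coefficients in \<open>Pt\<close> and \<open>Qt\<close>.\<close>
  have P3: "((\<lambda>\<tau>. P x \<tau>) has_real_derivative - P3 x t) (at t)"
    and Q3: "((\<lambda>\<tau>. Q x \<tau>) has_real_derivative - Q3 x t) (at t)" for x t
    using Pt[of x t] Qt[of x t]
    by (auto elim!: DERIV_cong simp: P1_def Q1_def P2_def Q2_def P3_def Q3_def
        field_simps power_numeral_reduce)
  \<comment> \<open>\<open>R\<close> is the product of the two exponential modes, whose rates add up
    to -A, the trace of the x-system.\<close>
  have Rx: "((\<lambda>\<xi>. R \<xi> t) has_real_derivative - A * R x t) (at x)" for x t
    unfolding R_def[abs_def]
    by (auto intro!: derivative_eq_intros P0 Q0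
        simp: P1_def Q1_def field_simps power_numeral_reduce)
  have Rt: "((\<lambda>\<tau>. R x \<tau>) has_real_derivative - (P x t * P3 x t - D * Q x t * Q3 x t) / 2) (at t)"
    for x t
    unfolding R_def[abs_def]
    by (auto intro!: derivative_eq_intros P3 Q3 simp: field_simps)
  define F where "F x t = 1 - P x t * c x t - 4 * B * Q x t * s x t + R x t" for x t
  define G where "G x t = A * (c x t - (A * Q x t + P x t) / 2)" for x t
  have F: "den x t = r * F x t" and G: "num x t = r * G x t" for x t
    by (simp_all add: den num F_def G_def c_def s_def R_def)
  have Rnz: "R x t \<noteq> 0" for x t
    using nz[of x t] by (simp add: R_def)
  \<comment> \<open>This is the inversion of both modes under reflection: (1/E1 + 1/E2) = P/R, and
    the difference changes sign, giving -Q/R.\<close>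
  have Pm: "P (-x) (-t) = P x t / R x t" and Qm: "Q (-x) (-t) = - Q x t / R x t" for x t
    by (simp_all add: reflect R_def)
  have Rm: "R (-x) (-t) = 1 / R x t" for x t
  proof -
    have "R (-x) (-t) = R x t / (R x t)\<^sup>2"
      unfolding R_def[of "-x"] Pm Qm using Rnz[of x t]
      by (simp add: power_divide) (simp add: R_def field_simps)
    then show ?thesis by (simp add: power2_eq_square)
  qed
  have cm: "c (-x) (-t) = c x t" and sm: "s (-x) (-t) = - s x t" for x t
    unfolding c_def s_def phi_def using cos_minus[of "2 * B * x + 8 * B ^ 3 * t"]
      sin_minus[of "2 * B * x + 8 * B ^ 3 * t"] by simp_all
  have cs: "(c x t)\<^sup>2 + (s x t)\<^sup>2 = 1" for x t
    by (simp add: c_def s_def)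
  \<comment> \<open>The \<open>refl\<close> arguments replace the abbreviations \<open>f\<close>,
    ..., \<open>h\<close> by their right-hand sides, so that \<open>alg\<close> matches the two
    bilinear goals left at the end.\<close>
  note alg = kink_bilinear_identities[OF cs D P1_def P2_def P3_def Q1_def Q2_def Q3_def R_def refl refl
      refl refl refl refl refl refl refl refl refl]
  have "nonlocal_mKdV_solution_on {(x, t). F x t \<noteq> 0} (\<lambda>x t. G x t / F x t)"
    unfolding F_def G_def
  proof (rule nonlocal_mKdV_Hirota)
    show "continuous_on UNIV (\<lambda>(x, t). 1 - P x t * c x t - 4 * B * Q x t * s x t + R x t)"
      unfolding c_def s_def R_def phi_def case_prod_unfold
      by (intro continuous_intros cont) auto
    fix x t
    show "((\<lambda>\<xi>. 1 - P \<xi> t * c \<xi> t - 4 * B * Q \<xi> t * s \<xi> t + R \<xi> t) has_real_derivative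
        - (P1 x t * c x t - 2 * B * P x t * s x t)
        - 4 * B * (Q1 x t * s x t + 2 * B * Q x t * c x t) - A * R x t) (at x)"
      by (auto intro!: derivative_eq_intros P0 Q0 cx sx Rx simp: algebra_simps)
    show "((\<lambda>\<xi>. - (P1 \<xi> t * c \<xi> t - 2 * B * P \<xi> t * s \<xi> t)
        - 4 * B * (Q1 \<xi> t * s \<xi> t + 2 * B * Q \<xi> t * c \<xi> t) - A * R \<xi> t) has_real_derivative
        - (P2 x t * c x t - 4 * B * P1 x t * s x t - 4 * B\<^sup>2 * P x t * c x t)
        - 4 * B * (Q2 x t * s x t + 4 * B * Q1 x t * c x t - 4 * B\<^sup>2 * Q x t * s x t)
        + A\<^sup>2 * R x t) (at x)"
      by (auto intro!: derivative_eq_intros P0 Q0 P1 Q1 cx sx Rx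
          simp: algebra_simps power2_eq_square)
    show "((\<lambda>\<xi>. - (P2 \<xi> t * c \<xi> t - 4 * B * P1 \<xi> t * s \<xi> t - 4 * B\<^sup>2 * P \<xi> t * c \<xi> t)
        - 4 * B * (Q2 \<xi> t * s \<xi> t + 4 * B * Q1 \<xi> t * c \<xi> t - 4 * B\<^sup>2 * Q \<xi> t * s \<xi> t)
        + A\<^sup>2 * R \<xi> t) has_real_derivative
        - (P3 x t * c x t - 6 * B * P2 x t * s x t - 12 * B\<^sup>2 * P1 x t * c x t
          + 8 * B ^ 3 * P x t * s x t)
        - 4 * B * (Q3 x t * s x t + 6 * B * Q2 x t * c x t - 12 * B\<^sup>2 * Q1 x t * s x t
          - 8 * B ^ 3 * Q x t * c x t) - A ^ 3 * R x t) (at x)"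
      by (auto intro!: derivative_eq_intros P0 Q0 P1 Q1 P2 Q2 cx sx Rx
          simp: algebra_simps power_numeral_reduce)
    show "((\<lambda>\<tau>. 1 - P x \<tau> * c x \<tau> - 4 * B * Q x \<tau> * s x \<tau> + R x \<tau>) has_real_derivative
        (P3 x t * c x t + 8 * B ^ 3 * P x t * s x t)
        + 4 * B * (Q3 x t * s x t - 8 * B ^ 3 * Q x t * c x t)
        - (P x t * P3 x t - D * Q x t * Q3 x t) / 2) (at t)"
      by (auto intro!: derivative_eq_intros P3 Q3 ct st Rt simp: field_simps)
    show "((\<lambda>\<xi>. A * (c \<xi> t - (A * Q \<xi> t + P \<xi> t) / 2)) has_real_derivative
        A * (- 2 * B * s x t - (A * Q1 x t + P1 x t) / 2)) (at x)"
      by (auto intro!: derivative_eq_intros P0 Q0 cx)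
    show "((\<lambda>\<xi>. A * (- 2 * B * s \<xi> t - (A * Q1 \<xi> t + P1 \<xi> t) / 2)) has_real_derivative
        A * (- 4 * B\<^sup>2 * c x t - (A * Q2 x t + P2 x t) / 2)) (at x)"
      by (auto intro!: derivative_eq_intros P1 Q1 sx simp: power2_eq_square)
    show "((\<lambda>\<xi>. A * (- 4 * B\<^sup>2 * c \<xi> t - (A * Q2 \<xi> t + P2 \<xi> t) / 2)) has_real_derivative
        A * (8 * B ^ 3 * s x t - (A * Q3 x t + P3 x t) / 2)) (at x)"
      by (auto intro!: derivative_eq_intros P2 Q2 cx simp: power_numeral_reduce)
    show "((\<lambda>\<tau>. A * (c x \<tau> - (A * Q x \<tau> + P x \<tau>) / 2)) has_real_derivative
        A * (- 8 * B ^ 3 * s x t + (A * Q3 x t + P3 x t) / 2)) (at t)"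
      by (auto intro!: derivative_eq_intros P3 Q3 ct simp: field_simps)
    \<comment> \<open>The multiplier is 1/R: reflection exchanges the terms 1 and \<open>R\<close>
      of the denominator and preserves the mixed terms, each up to division by
      \<open>R\<close>.\<close>
    show "1 / R x t \<noteq> 0"
      using Rnz by simp
    show "1 - P (-x) (-t) * c (-x) (-t) - 4 * B * Q (-x) (-t) * s (-x) (-t) + R (-x) (-t)
        = 1 / R x t * (1 - P x t * c x t - 4 * B * Q x t * s x t + R x t)"
      unfolding Pm Qm Rm cm sm using Rnz[of x t] by (simp add: field_simps)
    \<comment> \<open>This fixes \<open>h\<close> as \<open>R\<close> times the reflected numerator,
      in agreement with the form in \<open>kink_bilinear_identities\<close>.\<close>
    show "A * (c (-x) (-t) - (A * Q (-x) (-t) + P (-x) (-t)) / 2)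
        = 1 / R x t * (A * (R x t * c x t + (A * Q x t - P x t) / 2))"
      unfolding Pm Qm cm using Rnz[of x t] by (simp add: field_simps)
  qed (rule alg)+
  then show ?thesis
    using \<open>r \<noteq> 0\<close> by (simp add: F G)
qed

section \<open>The three regimes\<close>

text \<open>Here D = s1^2 > 0, so the linear system has the two distinct real rates -2 k_1 and -2
  k_2, with eigenmodes \<open>E1\<close> and \<open>E2\<close>.\<close>

lemma u_I_solution:
  assumes "A > 0" "B > 0" "B < A / 4" "\<gamma>1 \<in> {1, -1}" "\<gamma>2 \<in> {1, -1}"
  shows "nonlocal_mKdV_solution_on {(x, t). den_I A B \<gamma>1 \<gamma>2 x t \<noteq> 0} (u_I A B \<gamma>1 \<gamma>2)"
proof -
  define r where "r = s1 A B"
  define D where "D = A\<^sup>2 - 16 * B\<^sup>2"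
  have "(4 * B)\<^sup>2 < A\<^sup>2"
    using assms by (intro power_strict_mono) auto
  then have "D > 0" by (simp add: D_def power_mult_distrib)
  then have r: "r > 0" and r2: "D = r\<^sup>2"
    by (simp_all add: r_def s1_def D_def)
  define E1 where "E1 x t = \<gamma>1 * exp (phi_I A B 1 x t)" for x t
  define E2 where "E2 x t = \<gamma>2 * exp (phi_I A B 2 x t)" for x t
  define P where "P x t = E1 x t + E2 x t" for x t
  define Q where "Q x t = (E1 x t - E2 x t) / r" for x t
  \<comment> \<open>Since k_j = (A -+ r)/4, the coefficients 2 k_j and 8 k_j^3 become (A -+ r)/2 and
    (A -+ r)^3/8.\<close>
  have phi1: "phi_I A B 1 x t = - ((A - r) / 2) * x + (A - r) ^ 3 / 8 * t"
    and phi2: "phi_I A B 2 x t = - ((A + r) / 2) * x + (A + r) ^ 3 / 8 * t" for x t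
    by (simp_all add: phi_I_def kk_def r_def s1_def power_divide)
      (simp_all add: field_simps)
  have E1x: "((\<lambda>\<xi>. E1 \<xi> t) has_real_derivative - ((A - r) / 2) * E1 x t) (at x)"
    and E2x: "((\<lambda>\<xi>. E2 \<xi> t) has_real_derivative - ((A + r) / 2) * E2 x t) (at x)"
    and E1t: "((\<lambda>\<tau>. E1 x \<tau>) has_real_derivative (A - r) ^ 3 / 8 * E1 x t) (at t)"
    and E2t: "((\<lambda>\<tau>. E2 x \<tau>) has_real_derivative (A + r) ^ 3 / 8 * E2 x t) (at t)" for x t
    unfolding E1_def E2_def phi1 phi2 by (auto intro!: derivative_eq_intros)
  have \<gamma>: "\<gamma>1 * \<gamma>1 = 1" "\<gamma>2 * \<gamma>2 = 1" "\<gamma>1 \<noteq> 0" "\<gamma>2 \<noteq> 0"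
    using assms by auto
  have Enz: "E1 x t \<noteq> 0" "E2 x t \<noteq> 0" for x t
    using \<gamma> by (auto simp: E1_def E2_def)
  have "phi_I A B j (-x) (-t) = - phi_I A B j x t" for j x t
    by (simp add: phi_I_def)
  \<comment> \<open>A sign is its own inverse, which is where the restriction of \<gamma>1 and
    \<gamma>2 to 1 and -1 enters.\<close>
  then have Em: "E1 (-x) (-t) = 1 / E1 x t" "E2 (-x) (-t) = 1 / E2 x t" for x t
    using \<gamma> by (auto simp: E1_def E2_def exp_minus field_simps)
  have PQ: "(P x t)\<^sup>2 - D * (Q x t)\<^sup>2 = 4 * E1 x t * E2 x t" for x t
    using r by (simp add: P_def Q_def r2 power_divide) (simp add: power2_eq_square algebra_simps)
  have den: "den_I A B \<gamma>1 \<gamma>2 x t = r * (1 - P x t * cos (phi B x t)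
      - 4 * B * Q x t * sin (phi B x t) + ((P x t)\<^sup>2 - D * (Q x t)\<^sup>2) / 4)" for x t
    unfolding PQ using r
    by (simp add: den_I_def r_def[symmetric] P_def Q_def E1_def E2_def exp_add field_simps)
  have num: "num_I A B \<gamma>1 \<gamma>2 x t = r * (A * (cos (phi B x t) - (A * Q x t + P x t) / 2))" for x t
    using r by (simp add: num_I_def r_def[symmetric] P_def Q_def E1_def E2_def field_simps)
  show ?thesis
    unfolding u_I_def[abs_def]
  proof (rule kink_solution[where P = P and Q = Q and r = r and D = D])
    show "continuous_on UNIV (\<lambda>p. P (fst p) (snd p))"
      "continuous_on UNIV (\<lambda>p. Q (fst p) (snd p))"
      unfolding P_def Q_def E1_def E2_def phi_I_def using r by (auto intro!: continuous_intros)
    fix x t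
    show "((\<lambda>\<xi>. P \<xi> t) has_real_derivative (D * Q x t - A * P x t) / 2) (at x)"
      unfolding P_def Q_def r2 using r
      by (auto intro!: derivative_eq_intros E1x E2x simp: field_simps power2_eq_square)
    show "((\<lambda>\<xi>. Q \<xi> t) has_real_derivative (P x t - A * Q x t) / 2) (at x)"
      unfolding P_def Q_def using r
      by (auto intro!: derivative_eq_intros E1x E2x simp: field_simps)
    show "((\<lambda>\<tau>. P x \<tau>) has_real_derivative
        ((A ^ 3 + 3 * A * D) * P x t - (3 * A\<^sup>2 * D + D\<^sup>2) * Q x t) / 8) (at t)"
      unfolding P_def Q_def r2 using r
      by (auto intro!: derivative_eq_intros E1t E2t simp: field_simps power_numeral_reduce)
    show "((\<lambda>\<tau>. Q x \<tau>) has_real_derivative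
        ((A ^ 3 + 3 * A * D) * Q x t - (3 * A\<^sup>2 + D) * P x t) / 8) (at t)"
      unfolding P_def Q_def r2 using r
      by (auto intro!: derivative_eq_intros E1t E2t simp: field_simps power_numeral_reduce)
    show "(P x t)\<^sup>2 - D * (Q x t)\<^sup>2 \<noteq> 0"
      unfolding PQ using Enz by simp
    show "P (-x) (-t) = 4 * P x t / ((P x t)\<^sup>2 - D * (Q x t)\<^sup>2)"
      unfolding PQ unfolding P_def Em using Enz[of x t] by (simp add: field_simps)
    show "Q (-x) (-t) = - 4 * Q x t / ((P x t)\<^sup>2 - D * (Q x t)\<^sup>2)"
      unfolding PQ unfolding Q_def Em using Enz[of x t] r by (simp add: field_simps)
  qed (use r in \<open>simp_all add: D_def num den\<close>)
qed

text \<open>Here D < 0 and the modes are complex conjugate: with s = i r they are E1 = X - iY and E2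
  = X + iY, where X + iY = \<eta>1 exp(phi3 + i phi4). Hence P = E1 + E2 = 2X and Q = (E1 - E2)/s =
  -2Y/r are real.\<close>

lemma u_II_solution:
  assumes "A > 0" "B > A / 4" "\<eta>1 \<in> {1, -1}"
  shows "nonlocal_mKdV_solution_on {(x, t). den_II A B \<eta>1 x t \<noteq> 0} (u_II A B \<eta>1)"
proof -
  define r where "r = s2 A B"
  define D where "D = A\<^sup>2 - 16 * B\<^sup>2"
  have "A\<^sup>2 < (4 * B)\<^sup>2"
    using assms by (intro power_strict_mono) auto
  then have "D < 0" by (simp add: D_def power_mult_distrib)
  then have r: "r > 0" and r2: "D = - r\<^sup>2"
    by (simp_all add: r_def s2_def D_def)
  have B2: "B\<^sup>2 = (A\<^sup>2 + r\<^sup>2) / 16"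
    using r2 by (simp add: D_def)
  define X where "X x t = \<eta>1 * exp (phi3 A B x t) * cos (phi4 A B x t)" for x t
  define Y where "Y x t = \<eta>1 * exp (phi3 A B x t) * sin (phi4 A B x t)" for x t
  define P where "P x t = 2 * X x t" for x t
  define Q where "Q x t = - 2 * Y x t / r" for x t
  \<comment> \<open>Eliminating \<open>B\<close> through \<open>B2\<close> shows the phases to be
    the real and imaginary parts of -(A + i r)/2 x + (A + i r)^3/8 t.\<close>
  have phi3: "phi3 A B x t = - (A / 2) * x + (A ^ 3 - 3 * A * r\<^sup>2) / 8 * t"
    and phi4: "phi4 A B x t = - (r / 2) * x + (3 * A\<^sup>2 * r - r ^ 3) / 8 * t" for x t
    unfolding phi3_def phi4_def r_def[symmetric] B2
    by (simp_all add: field_simps power_numeral_reduce)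
  have Xx: "((\<lambda>\<xi>. X \<xi> t) has_real_derivative (r * Y x t - A * X x t) / 2) (at x)"
    and Yx: "((\<lambda>\<xi>. Y \<xi> t) has_real_derivative - (r * X x t + A * Y x t) / 2) (at x)"
    and Xt: "((\<lambda>\<tau>. X x \<tau>) has_real_derivative
      ((A ^ 3 - 3 * A * r\<^sup>2) * X x t - (3 * A\<^sup>2 * r - r ^ 3) * Y x t) / 8) (at t)"
    and Yt: "((\<lambda>\<tau>. Y x \<tau>) has_real_derivative
      ((A ^ 3 - 3 * A * r\<^sup>2) * Y x t + (3 * A\<^sup>2 * r - r ^ 3) * X x t) / 8) (at t)" for x t
    unfolding X_def Y_def phi3 phi4 by (auto intro!: derivative_eq_intros simp: field_simps)
  have \<eta>: "\<eta>1 * \<eta>1 = 1" "\<eta>1 \<noteq> 0"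
    using assms by auto
  have XY: "(X x t)\<^sup>2 + (Y x t)\<^sup>2 = exp (2 * phi3 A B x t)" for x t
  proof -
    have "(X x t)\<^sup>2 + (Y x t)\<^sup>2 = (\<eta>1 * \<eta>1) * (exp (phi3 A B x t))\<^sup>2
        * ((cos (phi4 A B x t))\<^sup>2 + (sin (phi4 A B x t))\<^sup>2)"
      unfolding X_def Y_def by (simp only: power_mult_distrib power2_eq_square[of \<eta>1] distrib_left)
    then show ?thesis by (simp add: \<eta> exp_double)
  qed
  have PQ: "(P x t)\<^sup>2 - D * (Q x t)\<^sup>2 = 4 * exp (2 * phi3 A B x t)" for x t
    using r by (simp add: P_def Q_def r2 power_divide power_mult_distrib XY[symmetric])
  have "phi3 A B (-x) (-t) = - phi3 A B x t" "phi4 A B (-x) (-t) = - phi4 A B x t" for x t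
    by (simp_all add: phi3 phi4)
  \<comment> \<open>Reflection sends X + iY to its inverse (X - iY)/(X^2 + Y^2), with the squared
    modulus given by \<open>XY\<close>.\<close>
  then have m: "X (-x) (-t) = X x t / exp (2 * phi3 A B x t)"
    "Y (-x) (-t) = - Y x t / exp (2 * phi3 A B x t)" for x t
    by (simp_all add: X_def Y_def exp_minus exp_double power2_eq_square field_simps)
  have den: "den_II A B \<eta>1 x t = r * (1 - P x t * cos (phi B x t)
      - 4 * B * Q x t * sin (phi B x t) + ((P x t)\<^sup>2 - D * (Q x t)\<^sup>2) / 4)" for x t
    unfolding PQ using r
    by (simp add: den_II_def r_def[symmetric] P_def Q_def X_def Y_def field_simps)
  have num: "num_II A B \<eta>1 x t = r * (A * (cos (phi B x t) - (A * Q x t + P x t) / 2))" for x t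
    using r by (simp add: num_II_def r_def[symmetric] P_def Q_def X_def Y_def field_simps)
  show ?thesis
    unfolding u_II_def[abs_def]
  proof (rule kink_solution[where P = P and Q = Q and r = r and D = D])
    show "continuous_on UNIV (\<lambda>p. P (fst p) (snd p))"
      "continuous_on UNIV (\<lambda>p. Q (fst p) (snd p))"
      unfolding P_def Q_def X_def Y_def phi3_def phi4_def using r
      by (auto intro!: continuous_intros)
    fix x t
    show "((\<lambda>\<xi>. P \<xi> t) has_real_derivative (D * Q x t - A * P x t) / 2) (at x)"
      unfolding P_def Q_def r2 using r
      by (auto intro!: derivative_eq_intros Xx simp: field_simps power2_eq_square)
    show "((\<lambda>\<xi>. Q \<xi> t) has_real_derivative (P x t - A * Q x t) / 2) (at x)"
      unfolding P_def Q_def using r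
      by (auto intro!: derivative_eq_intros Yx simp: field_simps)
    show "((\<lambda>\<tau>. P x \<tau>) has_real_derivative
        ((A ^ 3 + 3 * A * D) * P x t - (3 * A\<^sup>2 * D + D\<^sup>2) * Q x t) / 8) (at t)"
      unfolding P_def Q_def r2 using r
      by (auto intro!: derivative_eq_intros Xt simp: field_simps power_numeral_reduce)
    show "((\<lambda>\<tau>. Q x \<tau>) has_real_derivative
        ((A ^ 3 + 3 * A * D) * Q x t - (3 * A\<^sup>2 + D) * P x t) / 8) (at t)"
      unfolding P_def Q_def r2 using r
      by (auto intro!: derivative_eq_intros Yt simp: field_simps power_numeral_reduce)
    show "(P x t)\<^sup>2 - D * (Q x t)\<^sup>2 \<noteq> 0"
      unfolding PQ by simp
    show "P (-x) (-t) = 4 * P x t / ((P x t)\<^sup>2 - D * (Q x t)\<^sup>2)"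
      unfolding PQ unfolding P_def m by simp
    show "Q (-x) (-t) = - 4 * Q x t / ((P x t)\<^sup>2 - D * (Q x t)\<^sup>2)"
      unfolding PQ unfolding Q_def m by simp
  qed (use r in \<open>simp_all add: D_def num den\<close>)
qed

text \<open>Here D = 0 and the two rates coincide, so the system is a Jordan block. As s tends to 0
  with both signs equal to \<nu>1, P tends to 2E and (E1 - E2)/s to twice the s-derivative of E1 at
  0, which is the \<open>Q\<close> below with its linear factor x - 3/4 A^2 t.\<close>

lemma u_III_solution:
  assumes "B = A / 4" "\<nu>1 \<in> {1, -1}"
  shows "nonlocal_mKdV_solution_on {(x, t). den_III A B \<nu>1 x t \<noteq> 0} (u_III A B \<nu>1)"
proof -
  define E where "E x t = \<nu>1 * exp (phi5 A x t)" for x t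
  define P where "P x t = 2 * E x t" for x t
  define Q where "Q x t = E x t * (x - 3 / 4 * A\<^sup>2 * t)" for x t
  have phi5: "phi5 A x t = - (A / 2) * x + A ^ 3 / 8 * t" for x t
    by (simp add: phi5_def l1_def power_divide)
  have Ex: "((\<lambda>\<xi>. E \<xi> t) has_real_derivative - (A / 2) * E x t) (at x)"
    and Et: "((\<lambda>\<tau>. E x \<tau>) has_real_derivative A ^ 3 / 8 * E x t) (at t)" for x t
    unfolding E_def phi5 by (auto intro!: derivative_eq_intros)
  have \<nu>: "\<nu>1 * \<nu>1 = 1" "\<nu>1 \<noteq> 0"
    using assms by auto
  have Enz: "E x t \<noteq> 0" for x t
    using \<nu> by (simp add: E_def)
  have "phi5 A (-x) (-t) = - phi5 A x t" for x t
    by (simp add: phi5)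
  then have Em: "E (-x) (-t) = 1 / E x t" for x t
    using \<nu> by (auto simp: E_def exp_minus field_simps)
  have E2: "exp (2 * phi5 A x t) = (E x t)\<^sup>2" for x t
    using \<nu> by (simp add: E_def exp_double power_mult_distrib) (simp add: power2_eq_square)
  have den: "den_III A B \<nu>1 x t = 1 - P x t * cos (phi B x t)
      - 4 * B * Q x t * sin (phi B x t) + ((P x t)\<^sup>2 - 0 * (Q x t)\<^sup>2) / 4" for x t
    unfolding den_III_def E2
    by (simp add: P_def Q_def E_def assms power_numeral_reduce field_simps)
  have num: "num_III A B \<nu>1 x t = A * (cos (phi B x t) - (A * Q x t + P x t) / 2)" for x t
    by (simp add: num_III_def P_def Q_def E_def power_numeral_reduce field_simps)
  show ?thesis
    unfolding u_III_def[abs_def]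
  \<comment> \<open>The formula of this regime carries no prefactor corresponding to
    \<open>s1\<close> or \<open>s2\<close>, hence \<open>r = 1\<close>.\<close>
  proof (rule kink_solution[where P = P and Q = Q and r = 1 and D = 0])
    show "0 = A\<^sup>2 - 16 * B\<^sup>2"
      by (simp add: assms power_divide)
    show "continuous_on UNIV (\<lambda>p. P (fst p) (snd p))"
      "continuous_on UNIV (\<lambda>p. Q (fst p) (snd p))"
      unfolding P_def Q_def E_def phi5_def by (auto intro!: continuous_intros)
    fix x t
    show "((\<lambda>\<xi>. P \<xi> t) has_real_derivative (0 * Q x t - A * P x t) / 2) (at x)"
      unfolding P_def by (auto intro!: derivative_eq_intros Ex)
    show "((\<lambda>\<xi>. Q \<xi> t) has_real_derivative (P x t - A * Q x t) / 2) (at x)"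
      unfolding P_def Q_def by (auto intro!: derivative_eq_intros Ex simp: field_simps)
    show "((\<lambda>\<tau>. P x \<tau>) has_real_derivative
        ((A ^ 3 + 3 * A * 0) * P x t - (3 * A\<^sup>2 * 0 + 0\<^sup>2) * Q x t) / 8) (at t)"
      unfolding P_def by (auto intro!: derivative_eq_intros Et)
    show "((\<lambda>\<tau>. Q x \<tau>) has_real_derivative
        ((A ^ 3 + 3 * A * 0) * Q x t - (3 * A\<^sup>2 + 0) * P x t) / 8) (at t)"
      unfolding P_def Q_def by (auto intro!: derivative_eq_intros Et simp: field_simps)
    show "(P x t)\<^sup>2 - 0 * (Q x t)\<^sup>2 \<noteq> 0"
      using Enz by (simp add: P_def)
    show "P (-x) (-t) = 4 * P x t / ((P x t)\<^sup>2 - 0 * (Q x t)\<^sup>2)"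
      unfolding P_def Em using Enz[of x t] by (simp add: field_simps power2_eq_square)
    show "Q (-x) (-t) = - 4 * Q x t / ((P x t)\<^sup>2 - 0 * (Q x t)\<^sup>2)"
      unfolding P_def Q_def Em using Enz[of x t] by (simp add: field_simps power2_eq_square)
  qed (simp_all add: num den)
qed

theorem theorem3p1:
  fixes A B :: real
  assumes "A > 0" and "B > 0"
  shows
    "(B < A / 4 \<longrightarrow>
        (\<forall>\<gamma>1 \<in> {1, -1}. \<forall>\<gamma>2 \<in> {1, -1}.
           nonlocal_mKdV_solution_on {(x, t). den_I A B \<gamma>1 \<gamma>2 x t \<noteq> 0} (u_I A B \<gamma>1 \<gamma>2))) \<and>
     (B > A / 4 \<longrightarrow>
        (\<forall>\<eta>1 \<in> {1, -1}.
           nonlocal_mKdV_solution_on {(x, t). den_II A B \<eta>1 x t \<noteq> 0} (u_II A B \<eta>1))) \<and>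
     (B = A / 4 \<longrightarrow>
        (\<forall>\<nu>1 \<in> {1, -1}.
           nonlocal_mKdV_solution_on {(x, t). den_III A B \<nu>1 x t \<noteq> 0} (u_III A B \<nu>1)))"
  using assms by (intro conjI impI ballI)
    (rule u_I_solution u_II_solution u_III_solution; simp)+

end
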